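(* The number $f_{\mathrm{rack}}(n)$ of isomorphism classes of racks of order $n$ is at most $2^{(c+o(1))n^2}$ as $n\to\infty$, where $c=\frac{1}{6}(\log_2 24)+\frac{1}{2}(\log_2 3)\approx 1.5566$.
   Context: A rack is a set $X$ together with a binary operation $\vartriangleright:X\times X\to X$ such that (i) for all $y\in X$ the map $X\to X$, $x\mapsto x\vartriangleright y$, is a bijection; and (ii) for all $x,y,z\in X$, $(x\vartriangleright y)\vartriangleright z=(x\vartriangleright z)\vartriangleright(y\vartriangleright z)$. An isomorphism from a rack $(X,\vartriangleright)$ to a rack $(X',\vartriangleright')$ is a bijection $\theta:X\to X'$ such that $\theta(x)\vartriangleright'\theta(y)=\theta(x\vartriangleright y)$ for all $x,y\in X$. A rack has order $n$ if its underlying set is finite of cardinality $n$. *)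

theory Defs
  imports Complex_Main "HOL-Library.FuncSet" "HOL-Library.Landau_Symbols"
begin

definition rack :: "'a set \<Rightarrow> ('a \<Rightarrow> 'a \<Rightarrow> 'a) \<Rightarrow> bool" where
  "rack X op \<longleftrightarrow>
     (\<forall>x\<in>X. \<forall>y\<in>X. op x y \<in> X) \<and>
     (\<forall>y\<in>X. bij_betw (\<lambda>x. op x y) X X) \<and>
     (\<forall>x\<in>X. \<forall>y\<in>X. \<forall>z\<in>X. op (op x y) z = op (op x z) (op y z))"

definition rack_isomorphism ::
    "('a \<Rightarrow> 'b) \<Rightarrow> 'a set \<Rightarrow> ('a \<Rightarrow> 'a \<Rightarrow> 'a) \<Rightarrow> 'b set \<Rightarrow> ('b \<Rightarrow> 'b \<Rightarrow> 'b) \<Rightarrow> bool" where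
  "rack_isomorphism \<theta> X op X' op' \<longleftrightarrow>
     bij_betw \<theta> X X' \<and> (\<forall>x\<in>X. \<forall>y\<in>X. op' (\<theta> x) (\<theta> y) = \<theta> (op x y))"

definition isomorphic_racks ::
    "'a set \<Rightarrow> ('a \<Rightarrow> 'a \<Rightarrow> 'a) \<Rightarrow> 'b set \<Rightarrow> ('b \<Rightarrow> 'b \<Rightarrow> 'b) \<Rightarrow> bool" where
  "isomorphic_racks X op X' op' \<longleftrightarrow> (\<exists>\<theta>. rack_isomorphism \<theta> X op X' op')"

text \<open>
  Racks are pairs of a carrier and an operation. Restricting to carriers that are sets of natural
  numbers loses no isomorphism class (see \<open>rack_representative\<close> below). The values of the operation
  outside the carrier are arbitrary; isomorphism does not see them, so they do not affect the
  number of isomorphism classes.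
\<close>
definition racks_of_order :: "nat \<Rightarrow> (nat set \<times> (nat \<Rightarrow> nat \<Rightarrow> nat)) set" where
  "racks_of_order n = {(X, op). rack X op \<and> finite X \<and> card X = n}"

definition rack_iso_rel ::
    "nat \<Rightarrow> ((nat set \<times> (nat \<Rightarrow> nat \<Rightarrow> nat)) \<times> (nat set \<times> (nat \<Rightarrow> nat \<Rightarrow> nat))) set" where
  "rack_iso_rel n =
     {((X, op), (X', op')). (X, op) \<in> racks_of_order n \<and> (X', op') \<in> racks_of_order n \<and>
        isomorphic_racks X op X' op'}"

definition f_rack :: "nat \<Rightarrow> nat" where
  "f_rack n = card (racks_of_order n // rack_iso_rel n)"


lemma isomorphic_racks_refl: "isomorphic_racks X op X op"
  unfolding isomorphic_racks_def rack_isomorphism_def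
  by (rule exI[of _ id]) auto

lemma isomorphic_racks_sym:
  assumes "rack X op" and "isomorphic_racks X op X' op'"
  shows "isomorphic_racks X' op' X op"
proof -
  obtain t where t: "bij_betw t X X'" and
    h: "\<And>x y. x \<in> X \<Longrightarrow> y \<in> X \<Longrightarrow> op' (t x) (t y) = t (op x y)"
    using assms(2) unfolding isomorphic_racks_def rack_isomorphism_def by blast
  let ?s = "inv_into X t"
  have s: "bij_betw ?s X' X" using t by (rule bij_betw_inv_into)
  have "op (?s x) (?s y) = ?s (op' x y)" if "x \<in> X'" "y \<in> X'" for x y
  proof -
    have sx: "?s x \<in> X" "?s y \<in> X" using s that by (auto dest: bij_betwE)
    then have "op (?s x) (?s y) \<in> X" using assms(1) by (auto simp: rack_def)
    moreover have "op' x y = t (op (?s x) (?s y))"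
      using h[OF sx] that t by (simp add: bij_betw_inv_into_right)
    ultimately show ?thesis using t by (simp add: bij_betw_inv_into_left)
  qed
  then show ?thesis using s unfolding isomorphic_racks_def rack_isomorphism_def by blast
qed

lemma isomorphic_racks_trans:
  assumes "isomorphic_racks X op X' op'" and "isomorphic_racks X' op' X'' op''"
  shows "isomorphic_racks X op X'' op''"
proof -
  obtain s t where s: "rack_isomorphism s X op X' op'" and t: "rack_isomorphism t X' op' X'' op''"
    using assms unfolding isomorphic_racks_def by blast
  have "rack_isomorphism (t \<circ> s) X op X'' op''"
    using s t unfolding rack_isomorphism_def
    by (auto intro: bij_betw_trans dest: bij_betwE)
  then show ?thesis unfolding isomorphic_racks_def by blast
qed

lemma equiv_rack_iso_rel: "equiv (racks_of_order n) (rack_iso_rel n)"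
proof (rule equivI)
  show "rack_iso_rel n \<subseteq> racks_of_order n \<times> racks_of_order n"
    by (auto simp: rack_iso_rel_def)
  show "refl_on (racks_of_order n) (rack_iso_rel n)"
    by (auto simp: refl_on_def rack_iso_rel_def isomorphic_racks_refl)
  show "sym (rack_iso_rel n)"
    by (auto simp: sym_def rack_iso_rel_def racks_of_order_def intro: isomorphic_racks_sym)
  show "trans (rack_iso_rel n)"
    unfolding trans_def rack_iso_rel_def by (auto intro: isomorphic_racks_trans)
qed

lemma rack_representative:
  fixes X :: "'a set"
  assumes r: "rack X op" and fin: "finite X"
  shows "\<exists>op'. op' \<in> {..<card X} \<rightarrow>\<^sub>E ({..<card X} \<rightarrow>\<^sub>E {..<card X}) \<and>
           ({..<card X}, op') \<in> racks_of_order (card X) \<and>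
           isomorphic_racks X op {..<card X} op'"
proof -
  let ?N = "{..<card X}"
  obtain t where t: "bij_betw t X ?N"
    using ex_bij_betw_finite_nat[OF fin] by (auto simp: atLeast0LessThan)
  let ?s = "inv_into X t"
  have s: "bij_betw ?s ?N X" using t by (rule bij_betw_inv_into)
  have sX: "?s i \<in> X" if "i \<in> ?N" for i using s that by (auto dest: bij_betwE)
  have tN: "t x \<in> ?N" if "x \<in> X" for x using t that by (auto dest: bij_betwE)
  have st: "?s (t x) = x" if "x \<in> X" for x using t that by (simp add: bij_betw_inv_into_left)
  have cl: "op x y \<in> X" if "x \<in> X" "y \<in> X" for x y using r that by (auto simp: rack_def)
  define q where "q = (\<lambda>i\<in>?N. \<lambda>j\<in>?N. t (op (?s i) (?s j)))"
  have q: "q i j = t (op (?s i) (?s j))" if "i \<in> ?N" "j \<in> ?N" for i j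
    using that by (simp add: q_def)
  have qN: "q i j \<in> ?N" if "i \<in> ?N" "j \<in> ?N" for i j
    unfolding q[OF that] using sX cl tN that by blast
  have e: "q \<in> ?N \<rightarrow>\<^sub>E (?N \<rightarrow>\<^sub>E ?N)"
    using sX cl tN by (auto simp: q_def)
  have b: "bij_betw (\<lambda>i. q i j) ?N ?N" if j: "j \<in> ?N" for j
  proof -
    have "bij_betw (\<lambda>x. op x (?s j)) X X" using r sX[OF j] by (auto simp: rack_def)
    then have "bij_betw (t \<circ> ((\<lambda>x. op x (?s j)) \<circ> ?s)) ?N ?N"
      using s t by (blast intro: bij_betw_trans)
    then show ?thesis by (rule bij_betw_cong[THEN iffD1, rotated]) (simp only: q[OF _ j] comp_apply)
  qed
  have d: "q (q i j) k = q (q i k) (q j k)" if "i \<in> ?N" "j \<in> ?N" "k \<in> ?N" for i j k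
  proof -
    have "op (op (?s i) (?s j)) (?s k) = op (op (?s i) (?s k)) (op (?s j) (?s k))"
      using r sX that unfolding rack_def by blast
    moreover have "?s (q a b) = op (?s a) (?s b)" if "a \<in> ?N" "b \<in> ?N" for a b
      unfolding q[OF that] by (rule st) (use sX cl that in blast)
    ultimately show ?thesis using that qN
      by (simp only: q[of "q i j" k] q[of "q i k" "q j k"])
  qed
  have "rack ?N q" unfolding rack_def using qN b d by blast
  moreover have "q (t x) (t y) = t (op x y)" if "x \<in> X" "y \<in> X" for x y
    unfolding q[OF tN[OF that(1)] tN[OF that(2)]] by (simp only: st that)
  then have "rack_isomorphism t X op ?N q"
    unfolding rack_isomorphism_def using t by blast
  ultimately show ?thesis
    using e by (intro exI[of _ q]) (auto simp: racks_of_order_def isomorphic_racks_def)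
qed

lemma finite_rack_classes: "finite (racks_of_order n // rack_iso_rel n)"
proof -
  let ?F = "{..<n} \<rightarrow>\<^sub>E ({..<n} \<rightarrow>\<^sub>E {..<n})"
  have "racks_of_order n // rack_iso_rel n \<subseteq> (\<lambda>q. rack_iso_rel n `` {({..<n}, q)}) ` ?F"
  proof
    fix C assume "C \<in> racks_of_order n // rack_iso_rel n"
    then obtain X op where m: "(X, op) \<in> racks_of_order n" and
      C: "C = rack_iso_rel n `` {(X, op)}" by (auto elim!: quotientE)
    then have X: "rack X op" "finite X" "card X = n" by (auto simp: racks_of_order_def)
    obtain q where q: "q \<in> ?F" "({..<n}, q) \<in> racks_of_order n" "isomorphic_racks X op {..<n} q"
      using rack_representative[OF X(1,2)] unfolding X(3) by blast
    then have "((X, op), ({..<n}, q)) \<in> rack_iso_rel n" using m by (simp add: rack_iso_rel_def)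
    then have "C = rack_iso_rel n `` {({..<n}, q)}"
      unfolding C by (rule equiv_class_eq[OF equiv_rack_iso_rel])
    then show "C \<in> (\<lambda>q. rack_iso_rel n `` {({..<n}, q)}) ` ?F" using q(1) by blast
  qed
  moreover have "finite ?F" by (intro finite_PiE) auto
  ultimately show ?thesis by (meson finite_imageI finite_subset)
qed

end

theory Submission
  imports Defs "HOL-Real_Asymp.Real_Asymp"
begin

text \<open>
  Write \<open>f\<^sub>y\<close> for the permutation \<open>x \<mapsto> op x y\<close>. Choose a set \<open>W\<close> of points minimising the number of
  orbits of \<open>\<langle>f\<^sub>w : w \<in> W\<rangle>\<close> plus \<open>t * card W\<close>, where \<open>t\<close> is about \<open>sqrt n\<close>. Then \<open>W\<close> has at most about
  \<open>sqrt n\<close> elements, so that the \<open>f\<^sub>w\<close> take \<open>o(n\<^sup>2)\<close> bits, and no \<open>f\<^sub>y\<close> can merge many orbits: it maps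
  all but \<open>2 * t\<close> orbit representatives into their own orbits. Since the \<open>f\<^sub>w\<close> are automorphisms, the
  rack is determined by them together with the values of every \<open>f\<^sub>y\<close> at the representatives. For
  each \<open>y\<close>, up to the few exceptions, these values form a choice function of the orbits, and there
  are \<open>\<Prod> card C \<le> \<Prod> 2 ^ card C = 2 ^ n\<close> of these. This gives \<open>2 powr ((1 + o(1)) * n\<^sup>2)\<close> racks in all,
  and \<open>1\<close> is less than the required constant.
\<close>

section \<open>Orbits of right translations and recovery of a rack from a transversal\<close>

text \<open>For a rack with \<open>W\<close> inside \<open>X\<close> the classes are the orbits of
  the group generated by the maps \<open>x \<mapsto> op x w\<close>; the converse pairs supply the
  inverses. Intersecting with \<open>X \<times> X\<close> removes the reflexive pairs outside
  \<open>X\<close>.\<close>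

definition orbit_rel :: "'a set \<Rightarrow> ('a \<Rightarrow> 'a \<Rightarrow> 'a) \<Rightarrow> 'a set \<Rightarrow> ('a \<times> 'a) set" where
  "orbit_rel X op W =
     (let S = (\<lambda>(x, w). (x, op x w)) ` (X \<times> W) in (S \<union> S\<inverse>)\<^sup>* \<inter> X \<times> X)"

lemma equiv_orbit_rel: "equiv X (orbit_rel X op W)"
proof (rule equivI)
  let ?S = "(\<lambda>(x, w). (x, op x w)) ` (X \<times> W)"
  have "sym ((?S \<union> ?S\<inverse>)\<^sup>*)"
    by (intro sym_rtrancl sym_Un_converse)
  then show "sym (orbit_rel X op W)"
    unfolding orbit_rel_def Let_def by (intro sym_Int) (auto simp: sym_def)
  show "trans (orbit_rel X op W)"
    unfolding orbit_rel_def Let_def by (intro trans_Int trans_rtrancl) (auto simp: trans_def)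
qed (auto simp: orbit_rel_def refl_on_def)

lemma orbit_rel_step:
  assumes "x \<in> X" "w \<in> W" "op x w \<in> X"
  shows "(x, op x w) \<in> orbit_rel X op W"
  using assms unfolding orbit_rel_def Let_def by (auto intro!: r_into_rtrancl)

lemma orbit_rel_mono: "W \<subseteq> W' \<Longrightarrow> orbit_rel X op W \<subseteq> orbit_rel X op W'"
  unfolding orbit_rel_def Let_def by (intro Int_mono rtrancl_mono) auto

text \<open>The orbits can be read off from the columns of \<open>W\<close> alone, so recording
  these columns also fixes the orbits.\<close>

lemma orbit_rel_cong:
  assumes "\<And>x w. x \<in> X \<Longrightarrow> w \<in> W \<Longrightarrow> op x w = op' x w"
  shows "orbit_rel X op W = orbit_rel X op' W"
proof -
  have "(\<lambda>(x, w). (x, op x w)) ` (X \<times> W) = (\<lambda>(x, w). (x, op' x w)) ` (X \<times> W)"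
    by (rule image_cong) (use assms in auto)
  then show ?thesis by (simp add: orbit_rel_def)
qed

text \<open>The step is an equivalence because a path may traverse a generating pair
  backwards.\<close>

lemma orbit_rel_induct:
  assumes xy: "(x, y) \<in> orbit_rel X op W" and "P x"
    and step: "\<And>x w. x \<in> X \<Longrightarrow> w \<in> W \<Longrightarrow> P x \<longleftrightarrow> P (op x w)"
  shows "P y"
proof -
  let ?S = "(\<lambda>(x, w). (x, op x w)) ` (X \<times> W)"
  have "(x, y) \<in> (?S \<union> ?S\<inverse>)\<^sup>*" using xy by (simp add: orbit_rel_def Let_def)
  then show ?thesis
    by (induction rule: rtrancl_induct) (use \<open>P x\<close> step in auto)
qed

text \<open>
  The maps \<open>x \<mapsto> op x w\<close> with \<open>w \<in> W\<close> are automorphisms of both racks, so the set of \<open>x\<close> whose rows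
  agree is a union of orbits.
\<close>
lemma rack_eqI_on_transversal:
  assumes r: "rack X op" and r': "rack X op'"
    and W: "W \<subseteq> X" and agree: "\<And>x w. x \<in> X \<Longrightarrow> w \<in> W \<Longrightarrow> op x w = op' x w"
    and rep: "\<And>C. C \<in> X // orbit_rel X op W \<Longrightarrow> \<rho> C \<in> C"
    and row: "\<And>C y. C \<in> X // orbit_rel X op W \<Longrightarrow> y \<in> X \<Longrightarrow> op (\<rho> C) y = op' (\<rho> C) y"
    and x: "x \<in> X" and y: "y \<in> X"
  shows "op x y = op' x y"
proof -
  define P where "P = (\<lambda>x. x \<in> X \<and> (\<forall>y\<in>X. op x y = op' x y))"
  have cl: "op a b \<in> X" "op' a b \<in> X" if "a \<in> X" "b \<in> X" for a b
    using r r' that by (auto simp: rack_def)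
  have dist: "op (op a b) c = op (op a c) (op b c)" "op' (op' a b) c = op' (op' a c) (op' b c)"
    if "a \<in> X" "b \<in> X" "c \<in> X" for a b c
    using r r' that unfolding rack_def by blast+
  have bij: "bij_betw (\<lambda>x. op x c) X X" if "c \<in> X" for c
    using r that by (auto simp: rack_def)
  have step: "P a \<longleftrightarrow> P (op a w)" if a: "a \<in> X" and w: "w \<in> W" for a w
  proof
    have wX: "w \<in> X" using w W by auto
    assume "P a"
    have "op (op a w) b = op' (op a w) b" if b: "b \<in> X" for b
    proof -
      \<comment> \<open>Translation by \<open>w\<close> is onto, so every entry in the row of
        \<open>op a w\<close> is the image under it of an entry in the row of
        \<open>a\<close>.\<close>
      obtain z where z: "z \<in> X" "b = op z w"
        using bij[OF wX] b by (auto simp: bij_betw_def)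
      have "op (op a w) b = op (op a z) w" using dist(1) a z wX by simp
      also have "\<dots> = op' (op' a z) w"
        using \<open>P a\<close> z a w agree cl by (simp add: P_def)
      also have "\<dots> = op' (op' a w) (op' z w)" using dist(2) a z wX by simp
      also have "\<dots> = op' (op a w) b" using agree a z w by simp
      finally show ?thesis .
    qed
    then show "P (op a w)" using cl a wX by (simp add: P_def)
  next
    have wX: "w \<in> X" using w W by auto
    assume Pw: "P (op a w)"
    have "op a b = op' a b" if b: "b \<in> X" for b
    proof -
      have "op (op a b) w = op (op a w) (op b w)" using dist(1) a b wX by simp
      also have "\<dots> = op' (op' a w) (op' b w)"
        using Pw cl a b wX w agree by (simp add: P_def)
      also have "\<dots> = op' (op' a b) w" using dist(2) a b wX by simp
      also have "\<dots> = op (op' a b) w" using agree cl a b w by simp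
      \<comment> \<open>Translation by \<open>w\<close> is injective and can be cancelled.\<close>
      finally show ?thesis
        using bij[OF wX] cl a b unfolding bij_betw_def by (meson inj_onD)
    qed
    then show "P a" using a by (simp add: P_def)
  qed
  let ?C = "orbit_rel X op W `` {x}"
  have C: "?C \<in> X // orbit_rel X op W" using x by (rule quotientI)
  have "(\<rho> ?C, x) \<in> orbit_rel X op W"
    using rep[OF C] equiv_orbit_rel[of X op W] by (meson Image_singleton_iff equivE symD)
  moreover have "P (\<rho> ?C)"
    using rep[OF C] row[OF C] unfolding P_def by (auto simp: orbit_rel_def Let_def)
  ultimately have "P x" using step by (rule orbit_rel_induct)
  then show ?thesis using y by (simp add: P_def)
qed

section \<open>Merged classes and the choice of \<open>W\<close>\<close>

text \<open>Every class that is not itself a class of the coarser relation is merged with another one, so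
  a coarse class containing \<open>k \<ge> 2\<close> fine ones accounts for a loss of \<open>k - 1 \<ge> k / 2\<close> classes.\<close>
lemma card_merged_classes_le:
  assumes fin: "finite A" and R: "equiv A R" and S: "equiv A S" and sub: "R \<subseteq> S"
  shows "card {C \<in> A // R. \<exists>x\<in>C. \<exists>z\<in>A - C. (x, z) \<in> S} + 2 * card (A // S) \<le> 2 * card (A // R)"
proof -
  define B where "B = {C \<in> A // R. \<exists>x\<in>C. \<exists>z\<in>A - C. (x, z) \<in> S}"
  define F where "F = (\<lambda>D. {C \<in> A // R. S `` C = D})"
  have finR: "finite (A // R)" and finS: "finite (A // S)"
    using finite_quotient[OF fin] equiv_type R S by blast+
  have img: "(\<lambda>C. S `` C) ` (A // R) = A // S"
    using refines_equiv_image_eq[OF sub R S] .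
  have cardR: "card (A // R) = (\<Sum>D\<in>A // S. card (F D))"
    using sum.group[OF finR finS, of "\<lambda>C. S `` C" "\<lambda>_. 1::nat"] img by (simp add: F_def)
  have "B = (\<Union>D\<in>A // S. B \<inter> F D)"
    using img by (auto simp: B_def F_def)
  then have cardB: "card B \<le> (\<Sum>D\<in>A // S. card (B \<inter> F D))"
    using card_UN_le[OF finS, of "\<lambda>D. B \<inter> F D"] by simp
  \<comment> \<open>The estimate is made on each fibre \<open>F D\<close> and then summed: a fibre
    without merged classes is still nonempty, and one with a merged class has at least two
    elements.\<close>
  have "card (B \<inter> F D) + 2 \<le> 2 * card (F D)" if D: "D \<in> A // S" for D
  proof -
    have finF: "finite (F D)" using finR by (simp add: F_def)
    show ?thesis
    proof (cases "B \<inter> F D = {}")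
      case True
      have "D \<in> (\<lambda>C. S `` C) ` (A // R)" using D img by simp
      then obtain C where "C \<in> F D" by (auto simp: F_def)
      then have "card (F D) > 0" using finF by (auto simp: card_gt_0_iff)
      then show ?thesis using True by simp
    next
      case False
      then obtain C x z where C: "C \<in> A // R" "S `` C = D" and xz: "x \<in> C" "z \<in> A" "z \<notin> C" "(x, z) \<in> S"
        by (auto simp: B_def F_def)
      \<comment> \<open>The fine class of \<open>z\<close> is a second element of the fibre,
        distinct from \<open>C\<close> because \<open>z\<close> lies outside
        \<open>C\<close>.\<close>
      have "S `` (R `` {z}) = S `` {z}"
        using refines_equiv_class_eq2[OF sub R S] by blast
      also have "\<dots> = S `` {x}"
        using xz(4) S by (metis equiv_class_eq)
      also have "x \<in> A" using S xz(4) by (auto simp: equiv_def refl_on_def dest: equiv_type)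
      have "C = R `` {x}" using C(1) xz(1) R
        by (metis Image_singleton_iff equiv_class_eq quotientE)
      then have "S `` {x} = D"
        using refines_equiv_class_eq2[OF sub R S, of x] C(2) by simp
      finally have "R `` {z} \<in> F D" using xz(2) by (auto simp: F_def intro: quotientI)
      moreover have "z \<in> R `` {z}" using R xz(2) by (rule equiv_class_self)
      moreover have "C \<in> F D" using C by (simp add: F_def)
      ultimately have "{C, R `` {z}} \<subseteq> F D" "C \<noteq> R `` {z}" using xz(3) by auto
      then have "2 \<le> card (F D)"
        using card_mono[OF finF, of "{C, R `` {z}}"] by simp
      moreover have "card (B \<inter> F D) \<le> card (F D)" using finF by (intro card_mono) auto
      ultimately show ?thesis by simp
    qed
  qed
  then have "(\<Sum>D\<in>A // S. card (B \<inter> F D) + 2) \<le> (\<Sum>D\<in>A // S. 2 * card (F D))"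
    by (rule sum_mono)
  then have "(\<Sum>D\<in>A // S. card (B \<inter> F D)) + 2 * card (A // S) \<le> 2 * card (A // R)"
    unfolding cardR sum.distrib by (simp flip: sum_distrib_left)
  then show ?thesis using cardB unfolding B_def by linarith
qed

lemma card_quotient_le: "finite A \<Longrightarrow> card (A // R) \<le> card A"
proof -
  assume "finite A"
  moreover have "A // R = (\<lambda>x. R `` {x}) ` A" by (auto simp: quotient_def)
  ultimately show ?thesis by (simp add: card_image_le)
qed

text \<open>Comparing a minimiser with the empty set bounds \<open>card W\<close>; comparing it with
  \<open>insert y W\<close> shows that adjoining \<open>y\<close> loses at most \<open>t\<close>
  orbits, hence merges at most \<open>2 * t\<close>. The function \<open>\<rho>\<close> is fixed on
  all nonempty sets beforehand, since \<open>W\<close> depends on the rack.\<close>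

lemma exists_saturating_subset:
  fixes t :: nat
  assumes r: "rack X op" and fin: "finite X" and rep: "\<And>C. C \<noteq> {} \<Longrightarrow> \<rho> C \<in> C"
  obtains W where "W \<subseteq> X" "card W * t \<le> card X"
    "\<And>y. y \<in> X \<Longrightarrow>
       card {C \<in> X // orbit_rel X op W. op (\<rho> C) y \<notin> C} \<le> 2 * t"
proof -
  define \<Phi> where "\<Phi> = (\<lambda>W. card (X // orbit_rel X op W) + card W * t)"
  obtain W where W: "W \<subseteq> X" and min: "\<And>V. V \<subseteq> X \<Longrightarrow> \<Phi> W \<le> \<Phi> V"
    using ex_has_least_nat[of "\<lambda>W. W \<subseteq> X" "{}" \<Phi>] by auto
  have "card (X // orbit_rel X op {}) \<le> card X"
    using fin by (rule card_quotient_le)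
  then have "card W * t \<le> card X"
    using min[of "{}"] by (simp add: \<Phi>_def)
  moreover have "card {C \<in> X // orbit_rel X op W. op (\<rho> C) y \<notin> C} \<le> 2 * t"
    if y: "y \<in> X" for y
  proof -
    have \<rho>: "\<rho> C \<in> C" if "C \<in> X // orbit_rel X op W" for C
      using in_quotient_imp_non_empty[OF equiv_orbit_rel that] by (rule rep)
    let ?R = "orbit_rel X op W" and ?S = "orbit_rel X op (insert y W)"
    \<comment> \<open>Only an inequality, as \<open>y\<close> may already lie in
      \<open>W\<close>.\<close>
    have "card (insert y W) \<le> Suc (card W)" by (rule card_insert_le_m1) auto
    then have "card (insert y W) * t \<le> card W * t + t"
      by (metis add.commute mult_Suc mult_le_mono1)
    then have "card (X // ?R) \<le> card (X // ?S) + t"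
      using min[of "insert y W"] W y by (simp add: \<Phi>_def)
    moreover have "card {C \<in> X // ?R. \<exists>x\<in>C. \<exists>z\<in>X - C. (x, z) \<in> ?S} + 2 * card (X // ?S)
        \<le> 2 * card (X // ?R)"
      by (intro card_merged_classes_le fin equiv_orbit_rel orbit_rel_mono) auto
    \<comment> \<open>If \<open>y\<close> carries a representative out of its class, that move is a
      generating step for \<open>insert y W\<close> and joins the class to another one.\<close>
    moreover have "{C \<in> X // ?R. op (\<rho> C) y \<notin> C} \<subseteq> {C \<in> X // ?R. \<exists>x\<in>C. \<exists>z\<in>X - C. (x, z) \<in> ?S}"
    proof clarify
      fix C assume C: "C \<in> X // ?R" "op (\<rho> C) y \<notin> C"
      have "\<rho> C \<in> X" using C \<rho> in_quotient_imp_subset[OF equiv_orbit_rel] by blast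
      moreover from this have "op (\<rho> C) y \<in> X" using r y by (simp add: rack_def)
      ultimately show "\<exists>x\<in>C. \<exists>z\<in>X - C. (x, z) \<in> ?S"
        using \<rho>[OF C(1)] C(2) orbit_rel_step[of "\<rho> C" X y "insert y W" op] by blast
    qed
    then have "card {C \<in> X // ?R. op (\<rho> C) y \<notin> C}
        \<le> card {C \<in> X // ?R. \<exists>x\<in>C. \<exists>z\<in>X - C. (x, z) \<in> ?S}"
      using finite_quotient[OF fin equiv_type[OF equiv_orbit_rel]] by (intro card_mono) auto
    ultimately show ?thesis by linarith
  qed
  ultimately show ?thesis using that W by blast
qed

section \<open>Counting almost-choice functions\<close>

text \<open>Serves to bound the number of lists of length at most \<open>m\<close> over
  \<open>a\<close> letters.\<close>

lemma sum_powers_le: "(\<Sum>i\<le>m. (a::nat) ^ i) \<le> (a + 1) ^ m"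
proof (induction m)
  case (Suc m)
  have "a ^ Suc m \<le> a * (a + 1) ^ m" using power_mono[of a "a + 1" m] by simp
  then have "(\<Sum>i\<le>Suc m. a ^ i) \<le> (a + 1) ^ m + a * (a + 1) ^ m"
    using Suc by (simp only: sum.atMost_Suc add_mono)
  then show ?case by simp
qed simp

text \<open>The crude bound \<open>k < 2 ^ k\<close> is applied to each class, and the class sizes
  add up to \<open>card A\<close>. The leading constant 1 in the final exponent comes from
  here.\<close>

lemma prod_card_partition_le:
  assumes fin: "finite A" and R: "equiv A R"
  shows "(\<Prod>C\<in>A // R. card C) \<le> 2 ^ card A"
proof -
  have "(\<Prod>C\<in>A // R. card C) \<le> (\<Prod>C\<in>A // R. 2 ^ card C)"
    by (intro prod_mono) (auto intro: less_imp_le less_exp)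
  also have "\<dots> = 2 ^ (\<Sum>C\<in>A // R. card C)" by (simp add: power_sum)
  also have "(\<Sum>C\<in>A // R. card C) = card (\<Union>(A // R))"
    using R fin
    by (intro card_Union_disjoint[symmetric])
       (auto simp: pairwise_def disjnt_def dest: quotient_disj
          intro: finite_equiv_class[OF _ equiv_type])
  also have "\<Union>(A // R) = A" using R by (rule Union_quotient)
  finally show ?thesis .
qed

text \<open>Each member of \<open>Q\<close> is a true choice function overwritten by a list of at
  most \<open>m\<close> exceptional pairs of a class and a value. The two factors bound the choice
  functions and the lists.\<close>

lemma card_almost_choice_functions_le:
  fixes m :: nat
  assumes fin: "finite A" and R: "equiv A R"
  defines "Q \<equiv> {r \<in> A // R \<rightarrow>\<^sub>E A. card {C \<in> A // R. r C \<notin> C} \<le> m}"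
  shows "finite Q" "card Q \<le> 2 ^ card A * (card A ^ 2 + 1) ^ m"
proof -
  let ?P = "A // R"
  have finP: "finite ?P" using finite_quotient[OF fin equiv_type[OF R]] .
  show finQ: "finite Q"
    unfolding Q_def by (rule finite_subset[of _ "?P \<rightarrow>\<^sub>E A"]) (use finP fin in \<open>auto intro: finite_PiE\<close>)
  define L where "L = {ps. set ps \<subseteq> ?P \<times> A \<and> length ps \<le> m}"
  define dec where "dec = (\<lambda>(r0 :: 'a set \<Rightarrow> 'a, ps). \<lambda>C\<in>?P. (case map_of ps C of None \<Rightarrow> r0 C | Some v \<Rightarrow> v))"
  have finL: "finite L" unfolding L_def
    using finP fin by (intro finite_lists_length_le) auto
  have "Q \<subseteq> dec ` (Pi\<^sub>E ?P (\<lambda>C. C) \<times> L)"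
  proof
    fix r assume "r \<in> Q"
    then have r: "r \<in> ?P \<rightarrow>\<^sub>E A" and m: "card {C \<in> ?P. r C \<notin> C} \<le> m" by (auto simp: Q_def)
    let ?B = "{C \<in> ?P. r C \<notin> C}"
    obtain cs where cs: "set cs = ?B" "distinct cs"
      using finite_distinct_list[of ?B] finP by auto
    define ps where "ps = map (\<lambda>C. (C, r C)) cs"
    \<comment> \<open>At an exceptional class any member will do, since \<open>ps\<close> takes
      precedence in \<open>dec\<close>.\<close>
    define r0 where "r0 = (\<lambda>C\<in>?P. if r C \<in> C then r C else (SOME x. x \<in> C))"
    have "length ps \<le> m" using m cs distinct_card[OF cs(2)] by (simp add: ps_def)
    then have "ps \<in> L" using cs r by (auto simp: L_def ps_def)
    moreover have "r0 \<in> Pi\<^sub>E ?P (\<lambda>C. C)"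
      using in_quotient_imp_non_empty[OF R] by (auto simp: r0_def some_in_eq)
    moreover have "dec (r0, ps) = r"
    proof
      fix C
      have "map_of ps C = (if C \<in> ?B then Some (r C) else None)"
        using cs(1) by (auto simp: ps_def map_of_map_restrict restrict_map_def)
      then show "dec (r0, ps) C = r C"
        using r by (auto simp: dec_def r0_def PiE_def extensional_def)
    qed
    ultimately show "r \<in> dec ` (Pi\<^sub>E ?P (\<lambda>C. C) \<times> L)" by (intro image_eqI[of _ dec "(r0, ps)"]) simp_all
  qed
  moreover have "finite (Pi\<^sub>E ?P (\<lambda>C. C) \<times> L)"
    using finP finL finite_equiv_class[OF fin equiv_type[OF R]] by (simp add: finite_PiE)
  ultimately have "card Q \<le> card (Pi\<^sub>E ?P (\<lambda>C. C) \<times> L)"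
    by (rule surj_card_le[rotated])
  also have "\<dots> = (\<Prod>C\<in>?P. card C) * (\<Sum>i\<le>m. card (?P \<times> A) ^ i)"
    unfolding L_def using finP fin
    by (simp add: card_cartesian_product card_PiE card_lists_length_le)
  also have "\<dots> \<le> 2 ^ card A * (card A ^ 2 + 1) ^ m"
  proof (rule mult_le_mono[OF prod_card_partition_le[OF fin R]])
    have "(\<Sum>i\<le>m. card (?P \<times> A) ^ i) \<le> (card (?P \<times> A) + 1) ^ m" by (rule sum_powers_le)
    \<comment> \<open>There are at most \<open>card A\<close> classes, hence at most
      \<open>card A ^ 2\<close> possible pairs.\<close>
    also have "\<dots> \<le> (card A ^ 2 + 1) ^ m"
      using card_quotient_le[OF fin, of R]
      by (intro power_mono) (auto simp: card_cartesian_product power2_eq_square)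
    finally show "(\<Sum>i\<le>m. card (?P \<times> A) ^ i) \<le> (card A ^ 2 + 1) ^ m" .
  qed
  finally show "card Q \<le> 2 ^ card A * (card A ^ 2 + 1) ^ m" .
qed

section \<open>Counting rack operations on a fixed carrier\<close>

text \<open>Extensionality identifies operations that agree on \<open>X\<close>, which makes the set
  finite for finite \<open>X\<close>.\<close>

definition rack_tables :: "'a set \<Rightarrow> ('a \<Rightarrow> 'a \<Rightarrow> 'a) set" where
  "rack_tables X = {q \<in> X \<rightarrow>\<^sub>E (X \<rightarrow>\<^sub>E X). rack X q}"

lemma finite_rack_tables: "finite X \<Longrightarrow> finite (rack_tables X)"
  unfolding rack_tables_def
  by (rule finite_subset[of _ "X \<rightarrow>\<^sub>E (X \<rightarrow>\<^sub>E X)"]) (auto intro: finite_PiE)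

text \<open>Every isomorphism class has a member with carrier \<open>{..<n}\<close>, so labelled
  tables give an upper bound.\<close>

lemma f_rack_le_card_rack_tables: "f_rack n \<le> card (rack_tables {..<n})"
proof -
  let ?cl = "\<lambda>q. rack_iso_rel n `` {({..<n}, q)}"
  have "racks_of_order n // rack_iso_rel n \<subseteq> ?cl ` rack_tables {..<n}"
  proof
    fix C assume "C \<in> racks_of_order n // rack_iso_rel n"
    then obtain X op where m: "(X, op) \<in> racks_of_order n" and
      C: "C = rack_iso_rel n `` {(X, op)}" by (auto elim!: quotientE)
    then have X: "rack X op" "finite X" "card X = n" by (auto simp: racks_of_order_def)
    obtain q where q: "q \<in> {..<n} \<rightarrow>\<^sub>E ({..<n} \<rightarrow>\<^sub>E {..<n})"
      "({..<n}, q) \<in> racks_of_order n" "isomorphic_racks X op {..<n} q"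
      using rack_representative[OF X(1,2)] unfolding X(3) by blast
    then have "((X, op), ({..<n}, q)) \<in> rack_iso_rel n" using m by (simp add: rack_iso_rel_def)
    then have "C = ?cl q"
      unfolding C by (rule equiv_class_eq[OF equiv_rack_iso_rel])
    moreover have "q \<in> rack_tables {..<n}"
      using q by (auto simp: rack_tables_def racks_of_order_def)
    ultimately show "C \<in> ?cl ` rack_tables {..<n}" by blast
  qed
  then show ?thesis
    unfolding f_rack_def by (intro surj_card_le finite_rack_tables) auto
qed

text \<open>A table is encoded in two stages: first \<open>W\<close> with its columns, at most
  \<open>2 ^ n * n ^ (n * t)\<close> choices; then, for each of the \<open>n\<close> elements
  \<open>y\<close>, the values at the orbit representatives, which form an almost-choice
  function.\<close>

lemma card_rack_tables_le:
  assumes fin: "finite X" and t: "0 < t" "card X \<le> t * t"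
  defines "n \<equiv> card X"
  shows "card (rack_tables X) \<le> 2 ^ n * n ^ (n * t) * (2 ^ n * (n ^ 2 + 1) ^ (2 * t)) ^ n"
proof -
  define \<rho> where "\<rho> = (\<lambda>C::'a set. SOME x. x \<in> C)"
  define Q where "Q = (\<lambda>F W. {r \<in> X // orbit_rel X F W \<rightarrow>\<^sub>E X.
     card {C \<in> X // orbit_rel X F W. r C \<notin> C} \<le> 2 * t})"
  define data where "data = (SIGMA W:{W. W \<subseteq> X \<and> card W \<le> t}. X \<rightarrow>\<^sub>E (W \<rightarrow>\<^sub>E X))"
  \<comment> \<open>The tables for which a given pair is a valid first stage. These sets may
    overlap, which is harmless for an upper bound.\<close>
  define T where "T = (\<lambda>(W, F). {q \<in> rack_tables X. F = (\<lambda>x\<in>X. restrict (q x) W) \<and>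
     (\<forall>y\<in>X. card {C \<in> X // orbit_rel X q W. q (\<rho> C) y \<notin> C} \<le> 2 * t)})"
  let ?M = "2 ^ n * (n ^ 2 + 1) ^ (2 * t)"
  have rep: "\<rho> C \<in> C" if "C \<noteq> {}" for C
    unfolding \<rho>_def using that by (simp add: some_in_eq)
  have \<rho>: "\<rho> C \<in> C" if "C \<in> X // orbit_rel X q W" for C q W
    using in_quotient_imp_non_empty[OF equiv_orbit_rel that] by (rule rep)
  have \<rho>X: "\<rho> C \<in> X" if "C \<in> X // orbit_rel X q W" for C q W
    using \<rho>[OF that] in_quotient_imp_subset[OF equiv_orbit_rel that] by blast
  have data_fin: "finite data"
    unfolding data_def using fin by (auto intro!: finite_SigmaI finite_PiE intro: finite_subset)
  have "rack_tables X \<subseteq> (\<Union>d\<in>data. T d)"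
  proof
    fix q assume q: "q \<in> rack_tables X"
    then have r: "rack X q" by (simp add: rack_tables_def)
    obtain W where W: "W \<subseteq> X" "card W * t \<le> card X"
      and few: "\<And>y. y \<in> X \<Longrightarrow> card {C \<in> X // orbit_rel X q W. q (\<rho> C) y \<notin> C} \<le> 2 * t"
      using exists_saturating_subset[OF r fin rep, of t] by blast
    \<comment> \<open>Here \<open>card X \<le> t * t\<close> turns the penalty bound into
      \<open>card W \<le> t\<close>.\<close>
    have "card W * t \<le> t * t" using W(2) t(2) by (rule le_trans)
    then have "card W \<le> t" using t(1) by simp
    moreover have "(\<lambda>x\<in>X. restrict (q x) W) \<in> X \<rightarrow>\<^sub>E (W \<rightarrow>\<^sub>E X)"
      using r W(1) by (auto simp: rack_def)
    ultimately have "(W, \<lambda>x\<in>X. restrict (q x) W) \<in> data"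
      using W(1) by (auto simp: data_def)
    moreover have "q \<in> T (W, \<lambda>x\<in>X. restrict (q x) W)"
      using q few by (simp add: T_def)
    ultimately show "q \<in> (\<Union>d\<in>data. T d)" by blast
  qed
  then have "card (rack_tables X) \<le> card (\<Union>d\<in>data. T d)"
    by (intro card_mono finite_UN_I data_fin)
       (auto simp: T_def intro: finite_subset[OF _ finite_rack_tables[OF fin]])
  also have "\<dots> \<le> (\<Sum>d\<in>data. card (T d))" by (rule card_UN_le[OF data_fin])
  also have "\<dots> \<le> (\<Sum>d\<in>data. ?M ^ n)"
  proof (rule sum_mono)
    fix d assume "d \<in> data"
    then obtain W F where d: "d = (W, F)" and W: "W \<subseteq> X" by (auto simp: data_def)
    \<comment> \<open>All tables in \<open>T d\<close> have the orbits given by \<open>F\<close>, so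
      one codomain \<open>Q F W\<close> serves them all.\<close>
    have orb: "orbit_rel X q W = orbit_rel X F W" if "q \<in> T d" for q
      using that by (intro orbit_rel_cong) (auto simp: T_def d)
    have "inj_on (\<lambda>q. \<lambda>y\<in>X. \<lambda>C\<in>X // orbit_rel X F W. q (\<rho> C) y) (T d)"
    proof (rule inj_onI)
      fix q q' assume q: "q \<in> T d" and q': "q' \<in> T d"
        and eq: "(\<lambda>y\<in>X. \<lambda>C\<in>X // orbit_rel X F W. q (\<rho> C) y) =
                 (\<lambda>y\<in>X. \<lambda>C\<in>X // orbit_rel X F W. q' (\<rho> C) y)"
      have rk: "rack X q" "rack X q'" and ext: "q \<in> X \<rightarrow>\<^sub>E (X \<rightarrow>\<^sub>E X)" "q' \<in> X \<rightarrow>\<^sub>E (X \<rightarrow>\<^sub>E X)"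
        using q q' by (auto simp: T_def d rack_tables_def)
      have "p x w = F x w" if "p \<in> T d" "x \<in> X" "w \<in> W" for p x w
        using that by (auto simp: T_def d)
      then have agree: "q x w = q' x w" if "x \<in> X" "w \<in> W" for x w
        using q q' that by metis
      have row: "q (\<rho> C) y = q' (\<rho> C) y" if "C \<in> X // orbit_rel X q W" "y \<in> X" for C y
        using fun_cong[OF fun_cong[OF eq, of y], of C] that by (simp add: orb[OF q])
      have "q x y = q' x y" if "x \<in> X" "y \<in> X" for x y
        by (rule rack_eqI_on_transversal[OF rk W]) (fact agree \<rho> row that)+
      then show "q = q'"
        by (metis PiE_ext PiE_mem ext)
    qed
    moreover have "(\<lambda>q. \<lambda>y\<in>X. \<lambda>C\<in>X // orbit_rel X F W. q (\<rho> C) y) ` T d \<subseteq> X \<rightarrow>\<^sub>E Q F W"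
    proof clarify
      fix q assume q: "q \<in> T d"
      then have "rack X q" and few: "\<And>y. y \<in> X \<Longrightarrow>
          card {C \<in> X // orbit_rel X F W. q (\<rho> C) y \<notin> C} \<le> 2 * t"
        using orb[OF q] by (auto simp: T_def d rack_tables_def)
      have "(\<lambda>C\<in>X // orbit_rel X F W. q (\<rho> C) y) \<in> Q F W" if "y \<in> X" for y
      proof -
        have "{C \<in> X // orbit_rel X F W. (\<lambda>C\<in>X // orbit_rel X F W. q (\<rho> C) y) C \<notin> C} =
              {C \<in> X // orbit_rel X F W. q (\<rho> C) y \<notin> C}" by auto
        moreover have "q (\<rho> C) y \<in> X" if "C \<in> X // orbit_rel X F W" for C
          using \<open>rack X q\<close> \<rho>X[OF that] \<open>y \<in> X\<close> by (simp add: rack_def)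
        ultimately show ?thesis using few[OF that] by (auto simp: Q_def)
      qed
      then show "(\<lambda>y\<in>X. \<lambda>C\<in>X // orbit_rel X F W. q (\<rho> C) y) \<in> X \<rightarrow>\<^sub>E Q F W" by auto
    qed
    moreover have finQ: "finite (Q F W)" and cardQ: "card (Q F W) \<le> ?M"
      using card_almost_choice_functions_le[OF fin equiv_orbit_rel, of F W "2 * t"]
      by (simp_all add: Q_def n_def)
    moreover have "finite (X \<rightarrow>\<^sub>E Q F W)" using fin finQ by (auto intro: finite_PiE)
    ultimately have "card (T d) \<le> card (X \<rightarrow>\<^sub>E Q F W)" by (meson card_inj_on_le)
    also have "\<dots> = card (Q F W) ^ n" using fin by (simp add: card_PiE n_def)
    also have "\<dots> \<le> ?M ^ n" using cardQ by (rule power_mono) simp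
    finally show "card (T d) \<le> ?M ^ n" .
  qed
  also have "\<dots> = card data * ?M ^ n" by simp
  also have "card data \<le> 2 ^ n * n ^ (n * t)"
  proof -
    let ?V = "{W. W \<subseteq> X \<and> card W \<le> t}"
    have finV: "finite ?V" using fin by auto
    have "card data = (\<Sum>W\<in>?V. card (X \<rightarrow>\<^sub>E (W \<rightarrow>\<^sub>E X)))"
      unfolding data_def using finV fin
      by (intro card_SigmaI) (auto intro!: finite_PiE intro: finite_subset)
    also have "\<dots> \<le> (\<Sum>W\<in>?V. n ^ (n * t))"
    proof (rule sum_mono)
      fix W assume W: "W \<in> ?V"
      then have "finite W" using fin finite_subset by auto
      then have "card (X \<rightarrow>\<^sub>E (W \<rightarrow>\<^sub>E X)) = n ^ (card W * n)"
        using fin by (simp add: card_PiE n_def power_mult)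
      also have "\<dots> \<le> n ^ (n * t)"
      \<comment> \<open>Monotonicity in the exponent needs a base of at least 1; for
        \<open>n = 0\<close> both exponents vanish.\<close>
      proof (cases "n = 0")
        case False
        then show ?thesis using W by (intro power_increasing) (auto simp: mult.commute)
      qed simp
      finally show "card (X \<rightarrow>\<^sub>E (W \<rightarrow>\<^sub>E X)) \<le> n ^ (n * t)" .
    qed
    also have "\<dots> = card ?V * n ^ (n * t)" by simp
    also have "card ?V \<le> card (Pow X)" using fin by (intro card_mono) auto
    also have "card (Pow X) = 2 ^ n" using fin by (simp add: card_Pow n_def)
    finally show ?thesis by simp
  qed
  finally show ?thesis by simp
qed

section \<open>Asymptotics\<close>

text \<open>Bounding \<open>n\<^sup>2 + 1\<close> by \<open>(n + 1)\<^sup>2\<close> gives a common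
  base \<open>n + 1\<close>, with exponent \<open>n * t\<close> from the columns of \<open>W\<close>
  and \<open>4 * t * n\<close> from the exceptions.\<close>

lemma f_rack_le:
  assumes "0 < t" "n \<le> t * t"
  shows "f_rack n \<le> 2 ^ (n + n\<^sup>2) * (n + 1) ^ (5 * t * n)"
proof -
  have "f_rack n \<le> 2 ^ n * n ^ (n * t) * (2 ^ n * (n\<^sup>2 + 1) ^ (2 * t)) ^ n"
    using f_rack_le_card_rack_tables[of n] card_rack_tables_le[of "{..<n}" t] assms by simp
  also have "\<dots> \<le> 2 ^ n * (n + 1) ^ (n * t) * (2 ^ n * ((n + 1)\<^sup>2) ^ (2 * t)) ^ n"
    by (intro mult_le_mono power_mono) (auto simp: power2_eq_square)
  also have "\<dots> = 2 ^ (n + n\<^sup>2) * (n + 1) ^ (n * t + 4 * t * n)"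
  proof -
    have "(2 ^ n * ((n + 1)\<^sup>2) ^ (2 * t)) ^ n = 2 ^ (n * n) * (n + 1) ^ (2 * (2 * t) * n)"
      by (simp only: power_mult_distrib flip: power_mult)
    moreover have "n * t + 4 * t * n = n * t + 2 * (2 * t) * n" by simp
    ultimately show ?thesis by (simp only: power_add power2_eq_square mult_ac)
  qed
  also have "n * t + 4 * t * n = 5 * t * n" by simp
  finally show ?thesis .
qed

theorem theorem8:
  "\<exists>\<epsilon> :: nat \<Rightarrow> real. \<epsilon> \<in> o(\<lambda>_. 1) \<and>
     (\<forall>n. real (f_rack n) \<le>
            2 powr ((1 / 6 * log 2 24 + 1 / 2 * log 2 3 + \<epsilon> n) * real n ^ 2))"
proof (intro exI conjI allI)
  \<comment> \<open>Chosen so that \<open>\<epsilon> n * n\<^sup>2\<close> is the excess of the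
    exponent over \<open>n\<^sup>2\<close>, with \<open>t\<close> replaced by its bound
    \<open>sqrt n + 1\<close>.\<close>
  define \<epsilon> where "\<epsilon> = (\<lambda>n::nat. (1 + 5 * (sqrt (real n) + 1) * log 2 (real n + 1)) / real n)"
  show "\<epsilon> \<in> o(\<lambda>_. 1)" unfolding \<epsilon>_def by real_asymp
  fix n :: nat
  \<comment> \<open>The added 1 ensures \<open>n \<le> t * t\<close> and keeps \<open>t\<close>
    positive at \<open>n = 0\<close>.\<close>
  define t where "t = nat \<lfloor>sqrt (real n)\<rfloor> + 1"
  have tr: "real t = real_of_int \<lfloor>sqrt (real n)\<rfloor> + 1" by (simp add: t_def)
  have t: "sqrt (real n) \<le> real t" "real t \<le> sqrt (real n) + 1"
    unfolding tr by linarith+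
  have "real n = sqrt (real n) * sqrt (real n)" by simp
  also have "\<dots> \<le> real t * real t" using t by (intro mult_mono) auto
  finally have "n \<le> t * t" by (metis of_nat_le_iff of_nat_mult)
  then have "real (f_rack n) \<le> real (2 ^ (n + n\<^sup>2) * (n + 1) ^ (5 * t * n))"
    using f_rack_le[of t n] by (simp only: of_nat_le_iff) (simp add: t_def)
  also have "\<dots> = 2 powr (real (n + n\<^sup>2)) * (2 powr log 2 (real n + 1)) powr (real (5 * t * n))"
    by (simp add: powr_realpow add.commute flip: powr_realpow)
  also have "\<dots> = 2 powr (real n + real n ^ 2 + 5 * real t * real n * log 2 (real n + 1))"
    by (simp only: powr_powr flip: powr_add) (simp add: algebra_simps)
  also have "\<dots> \<le> 2 powr ((1 / 6 * log 2 24 + 1 / 2 * log 2 3 + \<epsilon> n) * real n ^ 2)"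
  proof (intro powr_mono)
    \<comment> \<open>From \<open>24 \<ge> 16\<close> and \<open>3 \<ge> 2\<close> the constant is
      at least \<open>4/6 + 1/2\<close>, which exceeds 1.\<close>
    have "log 2 (2 ^ 4) \<le> log 2 (24::real)" by (subst log_le_cancel_iff) simp_all
    moreover have "log 2 (2 ^ 4) = (4::real)" by (subst log_nat_power) simp_all
    moreover have "log 2 2 \<le> log 2 (3::real)" by (subst log_le_cancel_iff) simp_all
    moreover have "log 2 2 = (1::real)" by simp
    ultimately have c: "1 \<le> 1 / 6 * log 2 24 + 1 / 2 * log 2 (3::real)" by linarith
    \<comment> \<open>At \<open>n = 0\<close> division by zero makes \<open>\<epsilon> n\<close>
      zero, and both sides vanish.\<close>
    have "\<epsilon> n * real n ^ 2 = real n + 5 * (sqrt (real n) + 1) * real n * log 2 (real n + 1)"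
      by (cases "n = 0") (simp_all add: \<epsilon>_def field_simps power2_eq_square)
    moreover have "5 * real t * real n * log 2 (real n + 1)
        \<le> 5 * (sqrt (real n) + 1) * real n * log 2 (real n + 1)"
      using t by (intro mult_right_mono) auto
    ultimately have "real n + real n ^ 2 + 5 * real t * real n * log 2 (real n + 1)
        \<le> 1 * real n ^ 2 + \<epsilon> n * real n ^ 2" by linarith
    also have "\<dots> \<le> (1 / 6 * log 2 24 + 1 / 2 * log 2 3) * real n ^ 2 + \<epsilon> n * real n ^ 2"
      using c by (intro add_right_mono mult_right_mono) auto
    finally show "real n + real n ^ 2 + 5 * real t * real n * log 2 (real n + 1)
        \<le> (1 / 6 * log 2 24 + 1 / 2 * log 2 3 + \<epsilon> n) * real n ^ 2"
      by (simp add: algebra_simps)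
  qed simp
  finally show "real (f_rack n) \<le>
      2 powr ((1 / 6 * log 2 24 + 1 / 2 * log 2 3 + \<epsilon> n) * real n ^ 2)" .
qed

end
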